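(* Let $n, x, p \in \mathbb{N}$ with $n > x \ge p \ge 2$, and let $\{S_1, S_2, \ldots, S_x\}$ be a partition of $I_n = \{1,\ldots,n\}$ with $n_i = |S_i|$ satisfying $1 \le n_1 = n_2 = \cdots = n_p \le n_{p+1} \le \cdots \le n_x$. Let $Q_p = \sum_{j=1}^{p n_1} (n - j + 1)$ and $M = \frac{T_n}{x}$, where $T_n = \frac{n(n+1)}{2}$. If $M > \left\lfloor \frac{Q_p}{p} \right\rfloor$, then $\{S_1, \ldots, S_x\}$ is not a constant sum partition of $I_n$.
   Context: A partition $\{S_1,\ldots,S_x\}$ of $I_n = \{1,\ldots,n\}$ is a grouping of its elements into nonempty pairwise disjoint subsets with union $I_n$. Such a partition is a constant sum partition if $\sum_{a \in S_i} a$ is the same constant for all $i$, $1 \le i \le x$. *)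

theory Defs
  imports Complex_Main "HOL-Library.Disjoint_Sets"
begin

definition constant_sum_partition :: "nat \<Rightarrow> nat set set \<Rightarrow> bool" where
  "constant_sum_partition n P \<longleftrightarrow>
     partition_on {1..n} P \<and> (\<exists>c. \<forall>A\<in>P. \<Sum>A = c)"

definition T :: "nat \<Rightarrow> real" where
  "T n = real n * (real n + 1) / 2"

end

theory Submission
  imports Defs
begin

text \<open>If all blocks had the same sum \<open>c\<close>, adding up all \<open>x\<close> of them
  would give \<open>x * c = T n\<close>, so \<open>c = M\<close>. The first \<open>p\<close> blocks
  have equal size, so together they form a set of \<open>p * m 1\<close> elements of
  \<open>{1..n}\<close> with sum \<open>p * c\<close>. No set of that size can exceed the sum of the
  largest elements of \<open>{1..n}\<close>, which is \<open>Q\<close>; this extremal bound is the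
  lemma below. Hence \<open>c\<close> \<le> \<open>Q / p\<close>, and since \<open>c\<close> is an
  integer it is at most the floor, contradicting the bound on \<open>M\<close>.\<close>

lemma sum_subset_atLeastAtMost_le:
  fixes A :: "nat set"
  assumes "A \<subseteq> {1..n}"
  shows "int (\<Sum>A) \<le> (\<Sum>j = 1..card A. int n - int j + 1)"
proof -
  have "finite A"
    using assms finite_subset by blast
  then show ?thesis
    using assms
  \<comment> \<open>Elements enter in decreasing order, so each new \<open>b\<close> only has to be
    compared with the new last summand.\<close>
  proof (induction rule: finite_linorder_min_induct)
    case empty
    then show ?case by simp
  next
    case (insert b A)
    have "b \<notin> A"
      using insert.hyps by auto
    have "insert b A \<subseteq> {b..n}"
      using insert.hyps(2) insert.prems by (auto simp: subset_iff less_imp_le)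
    then have "card (insert b A) \<le> card {b..n}"
      by (intro card_mono) auto
    \<comment> \<open>The right-hand side is the summand at \<open>j = card A + 1\<close>.\<close>
    then have "int b \<le> int n - int (card A)"
      using insert.hyps insert.prems \<open>b \<notin> A\<close> by auto
    then show ?case
      using insert \<open>b \<notin> A\<close> by auto
  qed
qed

theorem theorem2p6:
  fixes n x p :: nat and S :: "nat \<Rightarrow> nat set" and m :: "nat \<Rightarrow> nat"
    and Q :: int and M :: real
  assumes "n > x" and "x \<ge> p" and "p \<ge> 2"
    and "inj_on S {1..x}" and "partition_on {1..n} (S ` {1..x})"
    and "\<forall>i\<in>{1..x}. m i = card (S i)"
    and "1 \<le> m 1"
    and "\<forall>i\<in>{1..p}. m i = m 1"
    and "\<forall>i\<in>{p..<x}. m i \<le> m (i + 1)"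
    and "Q = (\<Sum>j = 1..p * m 1. int n - int j + 1)"
    and "M = T n / real x"
    and "M > real_of_int \<lfloor>real_of_int Q / real p\<rfloor>"
  shows "\<not> constant_sum_partition n (S ` {1..x})"
proof
  assume "constant_sum_partition n (S ` {1..x})"
  then obtain c where c: "\<And>i. i \<in> {1..x} \<Longrightarrow> \<Sum>(S i) = c"
    by (auto simp: constant_sum_partition_def)
  have union: "(\<Union>i\<in>{1..x}. S i) = {1..n}"
    using assms(5) by (auto simp: partition_on_def)
  have fin: "finite (S i)" if "i \<in> {1..x}" for i
    
    by (rule finite_subset[of _ "{1..n}"]) (use union that in blast, simp)
  \<comment> \<open>The partition is a set of sets; injectivity of \<open>S\<close> turns distinct
    indices into distinct blocks.\<close>
  have disj: "S i \<inter> S j = {}" if "i \<in> {1..x}" "j \<in> {1..x}" "i \<noteq> j" for i j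
    using that by (intro disjointD[OF partition_onD2[OF assms(5)]])
      (auto simp: inj_on_eq_iff[OF assms(4)])
  \<comment> \<open>Applied with \<open>k = x\<close> to identify \<open>c\<close> with
    \<open>M\<close>, and with \<open>k = p\<close> for the extremal bound.\<close>
  have sum_union: "\<Sum>(\<Union>i\<in>{1..k}. S i) = k * c" if "k \<le> x" for k
  proof -
    have "\<Sum>(\<Union>i\<in>{1..k}. S i) = (\<Sum>i\<in>{1..k}. \<Sum>(S i))"
      using that fin disj by (intro sum.UNION_disjoint) auto
    then show ?thesis
      using that c by simp
  qed
  have "real x * real c = real (\<Sum>{1..n})"
    using sum_union[of x] union by simp
  also have "\<dots> = T n"
    using double_gauss_sum_from_Suc_0[of n, where 'a = real]
    by (simp add: T_def)
  finally have "M = real x * real c / real x"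
    using assms(11) by simp
  then have "M = real c"
    using assms(2,3) by simp
  have "card (\<Union>i\<in>{1..p}. S i) = (\<Sum>i\<in>{1..p}. card (S i))"
    using assms(2) fin disj by (intro card_UN_disjoint) auto
  also have "\<dots> = (\<Sum>i\<in>{1..p}. m 1)"
  proof (intro sum.cong refl)
    fix i
    assume "i \<in> {1..p}"
    then have "card (S i) = m i"
      using assms(2,6) by simp
    also have "\<dots> = m 1"
      using assms(8) \<open>i \<in> {1..p}\<close> by blast
    finally show "card (S i) = m 1" .
  qed
  finally have "card (\<Union>i\<in>{1..p}. S i) = p * m 1"
    by simp
  moreover have "(\<Union>i\<in>{1..p}. S i) \<subseteq> {1..n}"
    using assms(2) unfolding union[symmetric] by (intro UN_mono) auto
  ultimately have "int (p * c) \<le> Q"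
    using sum_subset_atLeastAtMost_le[of "\<Union>i\<in>{1..p}. S i" n]
      sum_union[OF assms(2)] assms(10) by metis
  then have "real_of_int (int (p * c)) \<le> real_of_int Q"
    by (simp only: of_int_le_iff)
  then have "real_of_int (int c) \<le> real_of_int Q / real p"
    using assms(3) by (simp add: field_simps)
  \<comment> \<open>Integrality of \<open>c\<close> is what sharpens the bound to the floor.\<close>
  then have "int c \<le> \<lfloor>real_of_int Q / real p\<rfloor>"
    by (simp only: le_floor_iff)
  then show False
    using assms(12) \<open>M = real c\<close> by linarith
qed

end
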